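(* For every integer $n\ge1$, the third factorial moment of the area statistic on parking functions of length $n$ is $$-\frac{175}{192}n^4-\frac{283}{192}n^3+\frac{199}{192}n^2+\frac{259}{192}n+\left(\frac{15}{32}n^3+\frac{521}{96}n^2+\frac{1219}{96}n+\frac{743}{96}\right)E_1(n),$$ and asymptotically, as $n\to\infty$, it equals $\frac{15}{128}\sqrt{2\pi}\cdot n^{9/2}+O(n^4)$.
   Context: A parking function of length $n$ is a vector of positive integers $(p_1,\dots,p_n)$, $1\le p_i\le n$, whose non-decreasing rearrangement satisfies $p_{(i)}\le i$ for $1\le i\le n$; there are $(n+1)^{n-1}$ of them. The area statistic is $\mathrm{Area}(p)=\frac{n(n+1)}{2}-\sum_{i=1}^n p_i$. Choose $p$ uniformly at random among parking functions of length $n$; the $k$-th factorial moment of the area is $E[A(A-1)\cdots(A-k+1)]$ with $A=\mathrm{Area}(p)$, and $E_1(n)=E[A]$ is its expectation. *)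

theory Defs
  imports "HOL-Probability.Probability" "HOL-Library.Landau_Symbols"
begin

(* A vector (p_1, ..., p_n) is a list of length n; list indices start at 0, so p_(i) is
   sort p ! (i - 1). *)
definition parking_functions :: "nat \<Rightarrow> nat list set" where
  "parking_functions n =
     {p. length p = n \<and> set p \<subseteq> {1..n} \<and> (\<forall>i\<in>{1..n}. sort p ! (i - 1) \<le> i)}"

(* Real-valued, so that the subtractions here and in the factorial moment are not truncated. *)
definition area :: "nat list \<Rightarrow> real" where
  "area p = real (length p) * (real (length p) + 1) / 2 - real (sum_list p)"

lemma finite_parking_functions: "finite (parking_functions n)"
proof (rule finite_subset)
  show "parking_functions n \<subseteq> {p. set p \<subseteq> {1..n} \<and> length p = n}"
    by (auto simp: parking_functions_def)
  show "finite {p. set p \<subseteq> {1..n} \<and> length p = n}"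
    by (rule finite_lists_length_eq) simp
qed

lemma parking_functions_nonempty: "parking_functions n \<noteq> {}"
proof -
  have "sort (replicate n (1::nat)) = replicate n 1"
    by (intro sort_key_id_if_sorted) (auto simp: sorted_replicate)
  hence "replicate n 1 \<in> parking_functions n"
    by (auto simp: parking_functions_def)
  thus ?thesis by blast
qed

definition random_parking_function :: "nat \<Rightarrow> nat list pmf" where
  "random_parking_function n = pmf_of_set (parking_functions n)"

definition area_factorial_moment :: "nat \<Rightarrow> nat \<Rightarrow> real" where
  "area_factorial_moment k n =
     measure_pmf.expectation (random_parking_function n) (\<lambda>p. \<Prod>i<k. area p - real i)"

definition expected_area :: "nat \<Rightarrow> real" where
  "expected_area n = measure_pmf.expectation (random_parking_function n) area"

end

theory Submission
  imports Defs "HOL-Computational_Algebra.Polynomial_FPS" "HOL-Real_Asymp.Real_Asymp"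
begin

unbundle no vec_syntax
unbundle fps_syntax

text \<open>
  The first idea is an inversion formula for the area enumerator. Weight a value \<open>v\<close> by \<open>x v\<close>,
  let \<open>P k\<close> be the total weight of the parking functions of length \<open>k\<close>, and let
  \<open>X k = x 1 + \<dots> + x k\<close>. Then for \<open>n > 0\<close>
  \<open>(\<Sum>k\<le>n. (n choose k) * (-1) ^ (n - k) * P k * X (k + 1) ^ (n - k)) = 0\<close>.
  The left-hand side is a signed count of pairs of a function on \<open>n\<close> cars and a set \<open>S\<close> of cars that
  park among themselves while all other cars have preferences at most \<open>card S + 1\<close>. Adding the car
  with the largest preference to \<open>S\<close>, or removing it, preserves this condition and flips the sign
  (\<open>parking_function_inversion\<close>).

  With \<open>x v = exp (s * (1 - v))\<close> and after a shift of exponents this becomes an identity for the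
  exponential generating functions of the area. Comparing coefficients of \<open>s\<close> up to \<open>s ^ 3\<close> gives
  recursions for the area moments. The coefficients are polynomials in \<open>n\<close> and \<open>k\<close>, times the
  Abel weight \<open>(- (k + 1)) ^ (n - k)\<close>.

  The second idea makes these recursions mechanical. The Abel transform sends a sequence \<open>a\<close> to
  the series \<open>\<Sum>k. a k * z ^ k * exp (- (k + 1) * z) / k!\<close>. It is injective. Multiplication by \<open>n\<close>
  acts on its image as the derivation \<open>z * d/dz\<close>, and multiplication by \<open>k\<close> acts through the same
  derivation (\<open>abel_transform_Suc\<close>). Both operators preserve the polynomials in \<open>z / (1 - z)\<close>. Since
  the number of parking functions is transformed to \<open>1\<close>, every area moment is transformed to such
  a polynomial, and these polynomials are computed one after the other. The claimed formula for the
  third factorial moment is then an identity between two explicit polynomials of degree 8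
  (\<open>third_factorial_moment_relation\<close>).

  For the asymptotics only the mean is needed. The image of the first moment is
  \<open>(z / (1 - z)) ^ 2 / 2\<close>, which inverts to a closed form in terms of Ramanujan's
  function, here shifted by 1, \<open>Q N = \<Sum>i\<le>N. N! / ((N - i)! * N ^ i)\<close> with \<open>N = n + 1\<close>
  (\<open>expected_area_ramanujan_Q\<close>). The value of \<open>Q N\<close> exceeds \<open>sqrt (pi * N / 2)\<close> by an amount
  between 0 and 2. The lower bound compares the integral representation of \<open>Q\<close> with a
  Gaussian integral, and the upper bound compares each summand with a Gaussian.
\<close>

section \<open>Inversion of the area enumerator\<close>

text \<open>
  This is the parking condition for cars from an arbitrary finite set, in counting form: for each
  \<open>i\<close> at least \<open>i\<close> cars prefer one of the spots up to \<open>i\<close>. Unlike the formulation by sorting, it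
  restricts well to subsets of cars.
\<close>

definition parks :: "'a set \<Rightarrow> ('a \<Rightarrow> nat) \<Rightarrow> bool" where
  "parks S f \<longleftrightarrow> (\<forall>i\<in>{1..card S}. i \<le> card {j\<in>S. f j \<le> i})"

lemma parks_cong: "(\<And>j. j \<in> S \<Longrightarrow> f j = g j) \<Longrightarrow> parks S f \<longleftrightarrow> parks S g"
proof -
  assume "\<And>j. j \<in> S \<Longrightarrow> f j = g j"
  hence "{j\<in>S. f j \<le> i} = {j\<in>S. g j \<le> i}" for i by auto
  thus ?thesis by (simp add: parks_def)
qed

lemma parks_le_card:
  assumes "parks S f" "finite S" "j \<in> S"
  shows   "f j \<le> card S"
proof -
  have "card S > 0" using assms by (auto simp: card_gt_0_iff)
  hence "card S \<le> card {j\<in>S. f j \<le> card S}" using assms(1) by (auto simp: parks_def)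
  hence "{j\<in>S. f j \<le> card S} = S" using assms(2) by (intro card_seteq) auto
  thus ?thesis using assms(3) by blast
qed

definition prefix_parks :: "'a set \<Rightarrow> ('a \<Rightarrow> nat) \<Rightarrow> 'a set \<Rightarrow> bool" where
  "prefix_parks A f S \<longleftrightarrow> parks S f \<and> (\<forall>i\<in>A - S. f i \<le> card S + 1)"

text \<open>
  Here is the involution. If the other cars have preferences at most \<open>card S + 1\<close>, then so has
  \<open>j\<close>, and \<open>j\<close> can take the spot \<open>card S + 1\<close>. Conversely, if \<open>j\<close> parks with \<open>S\<close>, then its
  preference, and by maximality every preference, is at most \<open>card S + 1\<close>; and removing the largest
  preference does not disturb the counts below it.
\<close>

lemma prefix_parks_toggle_max:
  assumes "finite A" "j \<in> A" and max: "\<And>i. i \<in> A \<Longrightarrow> f i \<le> f j" and S: "S \<subseteq> A - {j}"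
  shows   "prefix_parks A f (insert j S) \<longleftrightarrow> prefix_parks A f S"
proof -
  define k where "k = card S"
  have fin: "finite S" using assms by (meson finite_Diff finite_subset)
  have k': "card (insert j S) = k + 1" using S fin by (subst card_insert_disjoint) (auto simp: k_def)
  show ?thesis
  proof
    assume L: "prefix_parks A f (insert j S)"
    hence le: "f i \<le> k + 1" if "i \<in> A" for i
      using parks_le_card[of "insert j S" f j] max[OF that] fin k'
      by (fastforce simp: prefix_parks_def)
    have "i \<le> card {x\<in>S. f x \<le> i}" if i: "i \<in> {1..k}" for i
    proof (cases "f j \<le> i")
      case True
      hence "{x\<in>S. f x \<le> i} = S" using max S by force
      thus ?thesis using i by (simp add: k_def)
    next
      case False
      hence "{x\<in>insert j S. f x \<le> i} = {x\<in>S. f x \<le> i}" by auto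
      moreover have "i \<in> {1..card (insert j S)}" using i k' by simp
      hence "i \<le> card {x\<in>insert j S. f x \<le> i}"
        using L unfolding prefix_parks_def parks_def by blast
      ultimately show ?thesis by simp
    qed
    thus "prefix_parks A f S" using le by (auto simp: prefix_parks_def parks_def k_def)
  next
    assume R: "prefix_parks A f S"
    have j: "f j \<le> k + 1" using R S assms(2) by (auto simp: prefix_parks_def k_def)
    have "i \<le> card {x\<in>insert j S. f x \<le> i}" if i: "i \<in> {1..k + 1}" for i
    proof (cases "i = k + 1")
      case True
      have "{x\<in>insert j S. f x \<le> i} = insert j S" using j max S True by force
      thus ?thesis using True k' by simp
    next
      case False
      hence "i \<le> card {x\<in>S. f x \<le> i}" using R i by (auto simp: prefix_parks_def parks_def k_def)
      also have "\<dots> \<le> card {x\<in>insert j S. f x \<le> i}" using fin by (intro card_mono) auto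
      finally show ?thesis .
    qed
    moreover have "f i \<le> k + 2" if "i \<in> A" for i using j max[OF that] by simp
    ultimately show "prefix_parks A f (insert j S)"
      by (auto simp: prefix_parks_def parks_def k')
  qed
qed

lemma signed_sum_prefix_parks:
  assumes "finite A" "A \<noteq> {}"
  shows   "(\<Sum>S\<in>Pow A. if prefix_parks A f S then (-1) ^ card (A - S) else 0) = (0 :: 'b :: comm_ring_1)"
proof -
  obtain j where j: "j \<in> A" "\<And>i. i \<in> A \<Longrightarrow> f i \<le> f j"
    using assms obtains_MAX[of A f] by (metis Max_ge finite_imageI imageI)
  define B where "B = A - {j}"
  let ?g = "\<lambda>S. if prefix_parks A f S then (-1) ^ card (A - S) else (0 :: 'b)"
  have A: "A = insert j B" and finB: "finite B" and jB: "j \<notin> B" using j assms by (auto simp: B_def)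
  have "sum ?g (Pow A) = sum ?g (Pow B) + sum ?g (insert j ` Pow B)"
    unfolding A Pow_insert using finB jB by (intro sum.union_disjoint) auto
  also have "sum ?g (insert j ` Pow B) = (\<Sum>S\<in>Pow B. ?g (insert j S))"
    using jB by (subst sum.reindex) (auto simp: inj_on_def)
  also have "\<dots> = (\<Sum>S\<in>Pow B. - ?g S)"
  proof (intro sum.cong refl)
    fix S assume S: "S \<in> Pow B"
    have "A - S = insert j (A - insert j S)" using S j(1) jB by auto
    moreover have "card (insert j (A - insert j S)) = Suc (card (A - insert j S))"
      using assms(1) by (intro card_insert_disjoint) auto
    ultimately have "card (A - S) = Suc (card (A - insert j S))" by (simp only:)
    moreover have "prefix_parks A f (insert j S) \<longleftrightarrow> prefix_parks A f S"
      using S by (intro prefix_parks_toggle_max assms j) (auto simp: B_def)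
    ultimately show "?g (insert j S) = - ?g S" by simp
  qed
  finally show ?thesis by (simp add: sum_negf)
qed

lemma sorted_nth_le_iff:
  assumes "sorted xs" "i \<in> {1..length xs}"
  shows   "xs ! (i - 1) \<le> i \<longleftrightarrow> i \<le> length (filter (\<lambda>v. v \<le> i) xs)"
proof
  assume "xs ! (i - 1) \<le> i"
  moreover have "xs ! t \<le> xs ! (i - 1)" if "t < i" for t
    using that assms by (intro sorted_nth_mono) auto
  ultimately have "{..<i} \<subseteq> {t. t < length xs \<and> xs ! t \<le> i}"
    using assms(2) by (auto intro: order_trans)
  from card_mono[OF _ this] show "i \<le> length (filter (\<lambda>v. v \<le> i) xs)"
    by (simp add: length_filter_conv_card)
next
  assume *: "i \<le> length (filter (\<lambda>v. v \<le> i) xs)"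
  show "xs ! (i - 1) \<le> i"
  proof (rule ccontr)
    assume "\<not> xs ! (i - 1) \<le> i"
    hence "{t. t < length xs \<and> xs ! t \<le> i} \<subseteq> {..<i - 1}"
      using sorted_nth_mono[OF assms(1), of "i - 1"] by (fastforce simp: not_le[symmetric])
    from card_mono[OF _ this] have "length (filter (\<lambda>v. v \<le> i) xs) \<le> i - 1"
      by (simp add: length_filter_conv_card)
    moreover have "1 \<le> i" using assms by simp
    ultimately show False using * by linarith
  qed
qed

lemma parking_functions_iff:
  "p \<in> parking_functions n \<longleftrightarrow>
     length p = n \<and> set p \<subseteq> {1..n} \<and> (\<forall>i\<in>{1..n}. i \<le> length (filter (\<lambda>v. v \<le> i) p))"
proof -
  have "length (filter P (sort p)) = length (filter P p)" for P
    by (metis mset_filter mset_sort size_mset)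
  thus ?thesis
    using sorted_nth_le_iff[of "sort p"] by (auto simp: parking_functions_def)
qed

text \<open>
  An enumeration of \<open>S\<close> identifies the functions on \<open>S\<close> with lists of length \<open>card S\<close>, so that the
  total weight depends on \<open>S\<close> through its size only.
\<close>

lemma sum_parking_functions_conv_parks:
  fixes x :: "nat \<Rightarrow> 'b :: comm_ring_1"
  assumes "finite S"
  shows   "(\<Sum>f | f \<in> S \<rightarrow>\<^sub>E {1..card S} \<and> parks S f. \<Prod>i\<in>S. x (f i)) =
           (\<Sum>p\<in>parking_functions (card S). prod_list (map x p))"
proof -
  define k where "k = card S"
  obtain h where h: "bij_betw h {0..<k} S"
    using ex_bij_betw_nat_finite[OF assms] by (auto simp: k_def)
  define h' where "h' = inv_into {0..<k} h"
  have h'h: "h' (h t) = t" if "t < k" for t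
    using h that by (simp add: h'_def bij_betw_inv_into_left)
  have hh': "h (h' i) = i" "h' i < k" if "i \<in> S" for i
    using bij_betw_inv_into_right[OF h that] bij_betwE[OF bij_betw_inv_into[OF h]] that
    by (auto simp: h'_def)
  have hS: "h t \<in> S" if "t < k" for t using bij_betwE[OF h] that by auto
  have count: "length (filter P (map (\<lambda>t. f (h t)) [0..<k])) = card {i\<in>S. P (f i)}" for P f
  proof -
    have "{i\<in>S. P (f i)} = h ` {t. t < k \<and> P (f (h t))}"
      using hS hh' by (auto simp: image_iff) metis
    moreover have "inj_on h {t. t < k \<and> P (f (h t))}"
      using h by (auto simp: bij_betw_def inj_on_def)
    ultimately have "card {i\<in>S. P (f i)} = card {t. t < k \<and> P (f (h t))}"
      by (simp add: card_image)
    thus ?thesis unfolding length_filter_conv_card by (auto intro!: arg_cong[of _ _ card])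
  qed
  have parks_iff: "parks S f \<longleftrightarrow>
      (\<forall>i\<in>{1..k}. i \<le> length (filter (\<lambda>v. v \<le> i) (map (\<lambda>t. f (h t)) [0..<k])))" for f
    unfolding parks_def k_def [symmetric] by (intro ball_cong refl) (simp only: count)
  have restrict: "map (\<lambda>t. restrict (\<lambda>i. p ! h' i) S (h t)) [0..<k] = p" if "length p = k" for p
    using that hS h'h by (intro nth_equalityI) auto
  show ?thesis unfolding k_def [symmetric]
  proof (rule sum.reindex_bij_witness[of _ "\<lambda>p. restrict (\<lambda>i. p ! h' i) S"
            "\<lambda>f. map (\<lambda>t. f (h t)) [0..<k]"])
    fix f assume "f \<in> {f \<in> S \<rightarrow>\<^sub>E {1..k}. parks S f}"
    hence f: "f \<in> S \<rightarrow>\<^sub>E {1..k}" "parks S f" by auto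
    show "restrict (\<lambda>i. map (\<lambda>t. f (h t)) [0..<k] ! h' i) S = f"
      using f(1) hh' by (intro ext) (auto simp: restrict_def PiE_def extensional_def)
    show "map (\<lambda>t. f (h t)) [0..<k] \<in> parking_functions k"
      using f hS unfolding parking_functions_iff parks_iff by (auto simp: PiE_def Pi_def)
    have "(\<Prod>i\<in>S. x (f i)) = (\<Prod>t\<in>{0..<k}. x (f (h t)))"
      by (rule prod.reindex_bij_betw[OF h, symmetric])
    thus "prod_list (map x (map (\<lambda>t. f (h t)) [0..<k])) = (\<Prod>i\<in>S. x (f i))"
      using prod.distinct_set_conv_list[of "[0..<k]" "\<lambda>t. x (f (h t))"] by (simp add: o_def)
  next
    fix p assume "p \<in> parking_functions k"
    hence p: "length p = k" "set p \<subseteq> {1..k}"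
        "\<forall>i\<in>{1..k}. i \<le> length (filter (\<lambda>v. v \<le> i) p)"
      by (simp_all add: parking_functions_iff)
    show "map (\<lambda>t. restrict (\<lambda>i. p ! h' i) S (h t)) [0..<k] = p" by (rule restrict[OF p(1)])
    have "p ! h' i \<in> {1..k}" if "i \<in> S" for i
      using hh'(2)[OF that] p by (metis nth_mem subsetD)
    moreover have "parks S (restrict (\<lambda>i. p ! h' i) S)"
      unfolding parks_iff restrict[OF p(1)] by (rule p)
    ultimately show "restrict (\<lambda>i. p ! h' i) S \<in> {f \<in> S \<rightarrow>\<^sub>E {1..k}. parks S f}"
      by auto
  qed
qed

text \<open>
  The cars inside and outside of \<open>S\<close> are independent of each other: the former form a parking
  function, the latter choose freely among the first \<open>card S + 1\<close> spots.
\<close>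

lemma sum_prefix_parks:
  fixes x :: "nat \<Rightarrow> 'b :: comm_ring_1"
  assumes "finite A" "S \<subseteq> A"
  shows   "(\<Sum>f | f \<in> A \<rightarrow>\<^sub>E {1..card A} \<and> prefix_parks A f S. \<Prod>i\<in>A. x (f i)) =
           (\<Sum>p\<in>parking_functions (card S). prod_list (map x p)) *
           (\<Sum>v=1..card S + 1. x v) ^ card (A - S)"
proof -
  define k where "k = card S"
  have fin: "finite S" "finite (A - S)" using assms by (auto intro: finite_subset)
  have kn: "k \<le> card A" using assms by (simp add: k_def card_mono)
  have kn': "k + 1 \<le> card A" if "i \<in> A - S" for i
  proof -
    have "S \<subset> A" using that assms(2) by blast
    from psubset_card_mono[OF assms(1) this] show ?thesis by (simp add: k_def)
  qed
  have "(\<Sum>v=1..k + 1. x v) ^ card (A - S) = (\<Prod>i\<in>A - S. \<Sum>v=1..k + 1. x v)"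
    by simp
  also have "\<dots> = (\<Sum>h\<in>(A - S) \<rightarrow>\<^sub>E {1..k + 1}. \<Prod>i\<in>A - S. x (h i))"
    by (rule prod_sum_PiE) (use fin in auto)
  finally have "(\<Sum>p\<in>parking_functions k. prod_list (map x p)) * (\<Sum>v=1..k + 1. x v) ^ card (A - S) =
      (\<Sum>(g, h)\<in>{g. g \<in> S \<rightarrow>\<^sub>E {1..k} \<and> parks S g} \<times> ((A - S) \<rightarrow>\<^sub>E {1..k + 1}).
         (\<Prod>i\<in>S. x (g i)) * (\<Prod>i\<in>A - S. x (h i)))"
    unfolding k_def sum_parking_functions_conv_parks[OF fin(1), of x, symmetric]
    by (simp add: sum_product sum.cartesian_product)
  also have "\<dots> = (\<Sum>f | f \<in> A \<rightarrow>\<^sub>E {1..card A} \<and> prefix_parks A f S. \<Prod>i\<in>A. x (f i))"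
  proof (rule sum.reindex_bij_witness[of _ "\<lambda>f. (restrict f S, restrict f (A - S))"
            "\<lambda>(g, h). restrict (\<lambda>i. if i \<in> S then g i else h i) A"], goal_cases)
    case (1 gh)
    thus ?case using assms(2)
      by (auto simp: fun_eq_iff restrict_def PiE_def extensional_def)
  next
    case (2 gh)
    obtain g h where gh: "gh = (g, h)" by force
    have g: "\<And>i. i \<in> S \<Longrightarrow> g i \<in> {1..k}" "parks S g" and h: "\<And>i. i \<in> A - S \<Longrightarrow> h i \<in> {1..k + 1}"
      using 2 gh by auto
    let ?f = "restrict (\<lambda>i. if i \<in> S then g i else h i) A"
    have "parks S ?f" using g(2) assms(2) by (subst parks_cong[of S ?f g]) auto
    moreover have "?f i \<in> {1..card A}" if "i \<in> A" for i
      using g(1)[of i] h[of i] kn kn'[of i] that by (cases "i \<in> S") auto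
    ultimately show ?case using h by (auto simp: gh prefix_parks_def k_def)
  next
    case (3 f)
    thus ?case using assms(2)
      by (auto simp: fun_eq_iff restrict_def PiE_def extensional_def)
  next
    case (4 f)
    hence f: "\<And>i. i \<in> A \<Longrightarrow> f i \<in> {1..card A}" "parks S f" "\<And>i. i \<in> A - S \<Longrightarrow> f i \<le> k + 1"
      by (auto simp: prefix_parks_def k_def)
    have "parks S (restrict f S)" using f(2) by (subst parks_cong[of S "restrict f S" f]) auto
    moreover have "f i \<in> {1..k}" if "i \<in> S" for i
      using parks_le_card[OF f(2) fin(1) that] f(1)[of i] that assms(2) by (auto simp: k_def)
    moreover have "f i \<in> {1..k + 1}" if "i \<in> A - S" for i
      using f(1)[of i] f(3)[of i] that by auto
    ultimately show ?case by auto
  next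
    case (5 gh)
    obtain g h where gh: "gh = (g, h)" by force
    let ?f = "restrict (\<lambda>i. if i \<in> S then g i else h i) A"
    have "(\<Prod>i\<in>A. x (?f i)) = (\<Prod>i\<in>S. x (?f i)) * (\<Prod>i\<in>A - S. x (?f i))"
      by (subst prod.subset_diff[OF assms(2,1)]) (simp add: mult.commute)
    also have "(\<Prod>i\<in>S. x (?f i)) = (\<Prod>i\<in>S. x (g i))"
      using assms(2) by (intro prod.cong) auto
    also have "(\<Prod>i\<in>A - S. x (?f i)) = (\<Prod>i\<in>A - S. x (h i))"
      by (intro prod.cong) auto
    finally show ?case by (simp add: gh)
  qed
  finally show ?thesis by (simp add: k_def)
qed

lemma sum_Pow_card:
  fixes g :: "nat \<Rightarrow> 'b :: comm_ring_1"
  assumes "finite A"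
  shows   "(\<Sum>S\<in>Pow A. g (card S)) = (\<Sum>k\<le>card A. of_nat (card A choose k) * g k)"
proof -
  have "(\<Sum>S\<in>Pow A. g (card S)) = (\<Sum>k\<le>card A. \<Sum>S | S \<in> Pow A \<and> card S = k. g (card S))"
    using assms by (intro sum.group [symmetric]) (auto intro: card_mono)
  also have "\<dots> = (\<Sum>k\<le>card A. of_nat (card A choose k) * g k)"
    using n_subsets[OF assms] by (intro sum.cong refl) simp
  finally show ?thesis .
qed

text \<open>
  The sum over \<open>k\<close> is regrouped as a sum over sets \<open>S\<close> of cars, and each \<open>S\<close> contributes the weight
  of the functions that satisfy \<open>prefix_parks\<close> for \<open>S\<close>. After exchanging the two summations, each
  single function contributes 0 by \<open>signed_sum_prefix_parks\<close>.
\<close>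

theorem parking_function_inversion:
  fixes x :: "nat \<Rightarrow> 'b :: comm_ring_1"
  assumes "n > 0"
  shows   "(\<Sum>k\<le>n. of_nat (n choose k) * ((\<Sum>p\<in>parking_functions k. prod_list (map x p)) *
             (-1) ^ (n - k) * (\<Sum>v=1..k + 1. x v) ^ (n - k))) = 0"
proof -
  define A where "A = {..<n}"
  have A: "finite A" "A \<noteq> {}" "card A = n" using assms by (auto simp: A_def)
  let ?F = "A \<rightarrow>\<^sub>E {1..n}"
  let ?w = "\<lambda>f. \<Prod>i\<in>A. x (f i)"
  let ?P = "\<lambda>k. \<Sum>p\<in>parking_functions k. prod_list (map x p)"
  have finF: "finite ?F" using A by (intro finite_PiE) auto
  have "(\<Sum>k\<le>n. of_nat (n choose k) * (?P k * (-1) ^ (n - k) * (\<Sum>v=1..k + 1. x v) ^ (n - k))) =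
        (\<Sum>S\<in>Pow A. ?P (card S) * (-1) ^ (n - card S) * (\<Sum>v=1..card S + 1. x v) ^ (n - card S))"
    using sum_Pow_card[OF A(1), of "\<lambda>k. ?P k * (-1) ^ (n - k) * (\<Sum>v=1..k + 1. x v) ^ (n - k)"]
    by (simp add: A(3))
  also have "\<dots> = (\<Sum>S\<in>Pow A. (-1) ^ card (A - S) * (\<Sum>f | f \<in> ?F \<and> prefix_parks A f S. ?w f))"
  proof (intro sum.cong refl)
    fix S assume "S \<in> Pow A"
    hence S: "S \<subseteq> A" by simp
    hence "card (A - S) = n - card S"
      using A by (simp add: card_Diff_subset finite_subset)
    with sum_prefix_parks[OF A(1) S, of x]
    show "?P (card S) * (-1) ^ (n - card S) * (\<Sum>v=1..card S + 1. x v) ^ (n - card S) =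
          (-1) ^ card (A - S) * (\<Sum>f | f \<in> ?F \<and> prefix_parks A f S. ?w f)"
      by (simp add: A(3) mult_ac)
  qed
  also have "\<dots> = (\<Sum>S\<in>Pow A. \<Sum>f\<in>?F. ?w f * (if prefix_parks A f S then (-1) ^ card (A - S) else 0))"
    unfolding sum_distrib_left using finF
    by (intro sum.cong refl sum.mono_neutral_cong_left) auto
  also have "\<dots> = (\<Sum>f\<in>?F. ?w f * (\<Sum>S\<in>Pow A. if prefix_parks A f S then (-1) ^ card (A - S) else 0))"
    by (subst sum.swap) (simp add: sum_distrib_left)
  finally show ?thesis
    by (simp add: signed_sum_prefix_parks[OF A(1,2)])
qed

section \<open>The Abel transform\<close>

text \<open>
  For \<open>c n k = a k\<close> this is the Abel transform of \<open>a\<close>, that is, the exponential generating function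
  of \<open>a\<close> at \<open>z * exp (- z)\<close>, multiplied by \<open>exp (- z)\<close>. The more general form lets the weight
  depend on \<open>n\<close> as well, as the coefficients of the moment recursions do.
\<close>

definition abel_sum :: "(nat \<Rightarrow> nat \<Rightarrow> real) \<Rightarrow> real fps" where
  "abel_sum c = Abs_fps (\<lambda>n. \<Sum>k\<le>n. c n k * (- (real k + 1)) ^ (n - k) / (fact k * fact (n - k)))"

abbreviation abel_transform :: "(nat \<Rightarrow> real) \<Rightarrow> real fps" where
  "abel_transform a \<equiv> abel_sum (\<lambda>n k. a k)"

lemma abel_sum_nth:
  "abel_sum c $ n = (\<Sum>k\<le>n. c n k * (- (real k + 1)) ^ (n - k) / (fact k * fact (n - k)))"
  by (simp add: abel_sum_def)

lemma abel_sum_add: "abel_sum (\<lambda>n k. c n k + d n k) = abel_sum c + abel_sum d"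
  by (simp add: fps_eq_iff abel_sum_nth sum.distrib algebra_simps add_divide_distrib)

lemma abel_sum_scale: "abel_sum (\<lambda>n k. r * c n k) = fps_const r * abel_sum c"
  by (simp add: fps_eq_iff abel_sum_nth sum_distrib_left algebra_simps)

lemma abel_sum_row: "abel_sum (\<lambda>n k. real n * c n k) = fps_X * fps_deriv (abel_sum c)"
proof (rule fps_ext)
  fix n
  show "abel_sum (\<lambda>n k. real n * c n k) $ n = (fps_X * fps_deriv (abel_sum c)) $ n"
    by (cases n) (simp_all add: abel_sum_nth sum_distrib_left algebra_simps)
qed

text \<open>
  The transform is triangular with diagonal entries \<open>1 / n!\<close>.
\<close>

lemma abel_transform_inject:
  assumes "abel_transform a = abel_transform b"
  shows "a n = b n"
proof (induction n rule: less_induct)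
  case (less n)
  have split: "abel_transform f $ n = f n / fact n +
      (\<Sum>k<n. f k * (- (real k + 1)) ^ (n - k) / (fact k * fact (n - k)))" for f
    by (simp add: abel_sum_nth flip: lessThan_Suc_atMost)
  have "(\<Sum>k<n. a k * (- (real k + 1)) ^ (n - k) / (fact k * fact (n - k))) =
        (\<Sum>k<n. b k * (- (real k + 1)) ^ (n - k) / (fact k * fact (n - k)))"
    by (intro sum.cong refl) (simp add: less)
  with split[of a] split[of b] assms show ?case by simp
qed

text \<open>
  As the Abel transform substitutes \<open>z * exp (- z)\<close>, its variable \<open>z\<close> stands for Cayley's tree
  function \<open>T\<close>, and this series is \<open>T / (1 - T)\<close>.
\<close>

definition geom :: "real fps" where
  "geom = fps_X * inverse (1 - fps_X)"

lemma one_plus_geom: "(1 - fps_X) * (1 + geom) = 1"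
proof -
  have "(1 - fps_X) * inverse (1 - fps_X :: real fps) = 1"
    by (rule inverse_mult_eq_1') simp
  thus ?thesis by (simp add: geom_def algebra_simps)
qed

lemma cancel_one_minus_X:
  assumes "(1 - fps_X) * F = G"
  shows   "F = (1 + geom) * G"
proof -
  have "(1 + geom) * G = ((1 - fps_X) * (1 + geom)) * F"
    unfolding assms [symmetric] by (simp only: mult_ac)
  thus ?thesis by (simp add: one_plus_geom)
qed

lemma geom_nth_0 [simp]: "geom $ 0 = 0"
  by (simp add: geom_def)

lemma X_times_one_plus_geom: "fps_X * (1 + geom) = geom"
  using one_plus_geom by (simp add: algebra_simps)

lemma geom_nth: "geom $ n = (if n = 0 then 0 else 1)"
proof (induction n)
  case (Suc n)
  have "(fps_X * (1 + geom)) $ Suc n = geom $ Suc n" by (simp only: X_times_one_plus_geom)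
  with Suc show ?case by (auto split: if_splits)
qed auto

lemma X_deriv_geom: "fps_X * fps_deriv geom = geom * (1 + geom)"
proof -
  have "fps_deriv ((1 - fps_X) * (1 + geom)) = 0"
    by (subst one_plus_geom) simp
  hence "(1 - fps_X) * fps_deriv geom = 1 + geom"
    by (simp add: algebra_simps)
  hence "fps_deriv geom = (1 + geom) * (1 + geom)"
    by (rule cancel_one_minus_X)
  thus ?thesis using X_times_one_plus_geom by (simp flip: mult.assoc)
qed

text \<open>
  In the transform, multiplying the \<open>k\<close>-th term by \<open>k + 1\<close> and taking the difference of two
  consecutive coefficients produces the factor \<open>(k + 1) + (n - k) = n + 1\<close>, which no longer depends
  on \<open>k\<close>. Hence \<open>1 - z\<close> times the new transform is \<open>1 + z * d/dz\<close> applied to the old one.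
\<close>

lemma abel_transform_Suc:
  "abel_transform (\<lambda>k. (real k + 1) * a k) =
     (1 + geom) * (abel_transform a + fps_X * fps_deriv (abel_transform a))" (is "?L = _")
proof -
  have "(1 - fps_X) * ?L = abel_transform a + fps_X * fps_deriv (abel_transform a)"
  proof (rule fps_ext)
    fix n
    show "((1 - fps_X) * ?L) $ n = (abel_transform a + fps_X * fps_deriv (abel_transform a)) $ n"
    proof (cases n)
      case 0
      thus ?thesis by (simp add: abel_sum_nth)
    next
      case (Suc m)
      let ?t = "\<lambda>k. a k * (- (real k + 1)) ^ (n - k) / (fact k * fact (n - k))"
      \<comment> \<open>Lowering \<open>n\<close> by one trades a factor of the Abel weight for a factor of the factorial.\<close>
      have 1: "?L $ m = - (\<Sum>k\<le>m. real (n - k) * ?t k)"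
        unfolding abel_sum_nth sum_negf [symmetric]
      proof (intro sum.cong refl)
        fix k assume "k \<in> {..m}"
        hence nk: "n - k = Suc (m - k)" using Suc by auto
        show "(real k + 1) * a k * (- (real k + 1)) ^ (m - k) / (fact k * fact (m - k)) =
              - (real (n - k) * ?t k)"
          unfolding nk by (simp add: field_simps del: of_nat_Suc)
      qed
      have 2: "(\<Sum>k\<le>m. real (n - k) * ?t k) = (\<Sum>k\<le>n. real (n - k) * ?t k)"
        using Suc by simp
      have 3: "?L $ n = (\<Sum>k\<le>n. (real k + 1) * ?t k)"
        unfolding abel_sum_nth by (intro sum.cong) auto
      have "((1 - fps_X) * ?L) $ n = ?L $ n - ?L $ m"
        using Suc by (simp add: algebra_simps)
      also have "\<dots> = (\<Sum>k\<le>n. (real k + 1 + real (n - k)) * ?t k)"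
        unfolding 1 2 3 by (simp only: sum.distrib [symmetric] distrib_right diff_minus_eq_add)
      also have "\<dots> = (\<Sum>k\<le>n. (real n + 1) * ?t k)"
        by (intro sum.cong refl) auto
      also have "\<dots> = (real n + 1) * abel_transform a $ n"
        by (simp add: abel_sum_nth sum_distrib_left)
      finally show ?thesis using Suc by (simp add: algebra_simps)
    qed
  qed
  thus ?thesis by (rule cancel_one_minus_X)
qed

definition eval_geom :: "real poly \<Rightarrow> real fps" where
  "eval_geom P = fps_of_poly P oo geom"

lemma eval_geom_add: "eval_geom (P + Q) = eval_geom P + eval_geom Q"
  by (simp add: eval_geom_def fps_of_poly_add fps_compose_add_distrib)

lemma eval_geom_smult: "eval_geom (smult r P) = fps_const r * eval_geom P"
  by (simp add: eval_geom_def fps_of_poly_smult fps_const_mult_apply_left)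

lemma eval_geom_mult: "eval_geom (P * Q) = eval_geom P * eval_geom Q"
  by (simp add: eval_geom_def fps_of_poly_mult fps_compose_mult_distrib)

lemma eval_geom_simps [simp]: "eval_geom 1 = 1" "eval_geom [:0, 1:] = geom" "eval_geom 0 = 0"
  by (simp_all add: eval_geom_def fps_of_poly_pCons)

lemma eval_geom_1_1: "eval_geom [:1, 1:] = 1 + geom"
  by (simp add: eval_geom_def fps_of_poly_pCons fps_compose_add_distrib)

lemma eval_geom_0_1_1: "eval_geom [:0, 1, 1:] = geom * (1 + geom)"
proof -
  have "[:0, 1, 1:] = [:0, 1:] * [:1, 1 :: real:]" by simp
  thus ?thesis by (simp only: eval_geom_mult eval_geom_1_1 eval_geom_simps)
qed

text \<open>
  This operator is the derivation \<open>z * d/dz\<close>, written for polynomials in \<open>t = z / (1 - z)\<close>, where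
  it is \<open>(t + t\<^sup>2) * d/dt\<close>. It corresponds to multiplication by the row index \<open>n\<close>.
\<close>

definition row_op :: "real poly \<Rightarrow> real poly" where
  "row_op P = [:0, 1, 1:] * pderiv P"

text \<open>
  By \<open>abel_transform_Suc\<close> this operator corresponds to multiplication by the column index \<open>k\<close>.
\<close>

definition col_op :: "real poly \<Rightarrow> real poly" where
  "col_op P = [:1, 1:] * (P + row_op P) - P"

definition gap_op :: "real poly \<Rightarrow> real poly" where
  "gap_op P = row_op P - col_op P"

lemma row_op_0: "row_op 0 = 0"
  by (simp add: row_op_def)

text \<open>
  In this form the operators are computed coefficient by coefficient with \<open>pCons\<close> alone, without any
  polynomial multiplication.
\<close>

lemma row_op_pCons: "row_op (pCons c P) = pCons 0 (P + row_op P + pCons 0 P)"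
  by (simp add: row_op_def pderiv_pCons algebra_simps)

lemma col_op_eq: "col_op P = row_op P + pCons 0 (P + row_op P)"
  by (simp add: col_op_def)

lemma gap_op_eq: "gap_op P = - pCons 0 (P + row_op P)"
  by (simp add: gap_op_def col_op_eq)

lemmas op_eqs = row_op_0 row_op_pCons col_op_eq gap_op_eq

lemma eval_geom_row_op: "eval_geom (row_op P) = fps_X * fps_deriv (eval_geom P)"
proof -
  have "fps_X * fps_deriv (eval_geom P) = (fps_X * fps_deriv geom) * eval_geom (pderiv P)"
    by (simp add: eval_geom_def fps_compose_deriv fps_of_poly_pderiv mult_ac)
  thus ?thesis by (simp only: X_deriv_geom row_op_def eval_geom_mult eval_geom_0_1_1)
qed

definition represents :: "(nat \<Rightarrow> nat \<Rightarrow> real) \<Rightarrow> real poly \<Rightarrow> bool" where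
  "represents c P \<longleftrightarrow> abel_sum c = eval_geom P"

lemma represents_cong: "represents c P \<Longrightarrow> (\<And>n k. c n k = d n k) \<Longrightarrow> represents d P"
  by (simp add: represents_def abel_sum_def)

lemma represents_add:
  "represents c P \<Longrightarrow> represents d Q \<Longrightarrow> represents (\<lambda>n k. c n k + d n k) (P + Q)"
  by (simp add: represents_def abel_sum_add eval_geom_add)

lemma represents_scale: "represents c P \<Longrightarrow> represents (\<lambda>n k. r * c n k) (smult r P)"
  by (simp add: represents_def abel_sum_scale eval_geom_smult)

lemma represents_diff:
  "represents c P \<Longrightarrow> represents d Q \<Longrightarrow> represents (\<lambda>n k. c n k - d n k) (P - Q)"
  using represents_add[of c P "\<lambda>n k. -1 * d n k" "smult (-1) Q"] represents_scale[of d Q "-1"] by simp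

lemma represents_row: "represents c P \<Longrightarrow> represents (\<lambda>n k. real n * c n k) (row_op P)"
  by (simp add: represents_def abel_sum_row eval_geom_row_op)

lemma represents_col:
  assumes "represents (\<lambda>n k. a k) P"
  shows   "represents (\<lambda>n k. real k * a k) (col_op P)"
proof -
  have "represents (\<lambda>n k. (real k + 1) * a k) ([:1, 1:] * (P + row_op P))"
    using assms unfolding represents_def abel_transform_Suc
    by (simp only: eval_geom_mult eval_geom_add eval_geom_row_op eval_geom_1_1)
  from represents_diff[OF this assms] show ?thesis
    by (simp add: col_op_def algebra_simps)
qed

lemma represents_gap:
  assumes "represents (\<lambda>n k. a k) P"
  shows   "represents (\<lambda>n k. (real n - real k) * a k) (gap_op P)"
  using represents_diff[OF represents_row[OF assms] represents_col[OF assms]]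
  by (simp add: gap_op_def algebra_simps)

text \<open>
  One factor \<open>n - k\<close> is split into \<open>n\<close> and \<open>k\<close>. The column index has to act first, directly on the
  sequence, since \<open>abel_transform_Suc\<close> applies to weights that do not depend on \<open>n\<close>.
\<close>

definition gap2_op :: "real poly \<Rightarrow> real poly" where
  "gap2_op P = row_op (gap_op P) - gap_op (col_op P)"

lemma represents_gap2:
  assumes "represents (\<lambda>n k. a k) P"
  shows   "represents (\<lambda>n k. (real n - real k) ^ 2 * a k) (gap2_op P)"
  using represents_diff[OF represents_row[OF represents_gap[OF assms]]
                           represents_gap[OF represents_col[OF assms]]]
  by (simp add: gap2_op_def algebra_simps power2_eq_square)

definition gap3_op :: "real poly \<Rightarrow> real poly" where
  "gap3_op P = row_op (gap2_op P) - gap2_op (col_op P)"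

lemma represents_gap3:
  assumes "represents (\<lambda>n k. a k) P"
  shows   "represents (\<lambda>n k. (real n - real k) ^ 3 * a k) (gap3_op P)"
  using represents_diff[OF represents_row[OF represents_gap2[OF assms]]
                           represents_gap2[OF represents_col[OF assms]]]
  by (simp add: gap3_op_def algebra_simps power2_eq_square power3_eq_cube)

definition dec_op :: "real poly \<Rightarrow> real poly" where
  "dec_op P = row_op P - P"

lemma represents_dec:
  assumes "represents c P"
  shows   "represents (\<lambda>n k. (real n - 1) * c n k) (dec_op P)"
  using represents_diff[OF represents_row[OF assms] assms]
  by (simp add: dec_op_def algebra_simps)

text \<open>
  \<open>drift\<close> and \<open>spread\<close> are the coefficients of \<open>s\<close> and \<open>s\<^sup>2\<close> in the logarithm of the factor that
  accompanies the parking functions of length \<open>k\<close> in the inversion formula for length \<open>n\<close>; see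
  \<open>has_cumulants_complement_factor\<close>.
\<close>

definition drift :: "nat \<Rightarrow> nat \<Rightarrow> real" where
  "drift n k = (real n - real k) * (real n - 1) / 2"

definition spread :: "nat \<Rightarrow> nat \<Rightarrow> real" where
  "spread n k = (real n - real k) * real k * (real k + 2) / 24"

lemma represents_drift:
  assumes "represents (\<lambda>n k. a k) P"
  shows   "represents (\<lambda>n k. drift n k * a k) (smult (1/2) (dec_op (gap_op P)))"
  by (rule represents_cong[OF represents_scale[OF represents_dec[OF represents_gap[OF assms]]]])
     (simp add: drift_def)

definition spread_col_op :: "real poly \<Rightarrow> real poly" where
  "spread_col_op P = smult (1/24) (col_op (col_op P) + smult 2 (col_op P))"

lemma represents_spread_col:
  assumes "represents (\<lambda>n k. a k) P"
  shows   "represents (\<lambda>n k. real k * (real k + 2) / 24 * a k) (spread_col_op P)"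
proof -
  note col = represents_col[OF assms]
  show ?thesis unfolding spread_col_op_def
    by (rule represents_cong[OF represents_scale[OF
          represents_add[OF represents_col[OF col] represents_scale[OF col]]]])
       (simp add: field_simps)
qed

text \<open>
  The weights in this lemma and the next one are the coefficients of \<open>s\<^sup>2\<close> and \<open>s ^ 3\<close> in
  \<open>exp (drift n k * s + spread n k * s\<^sup>2)\<close>.
\<close>

lemma represents_weight2:
  assumes "represents (\<lambda>n k. a k) P"
  shows   "represents (\<lambda>n k. (drift n k ^ 2 / 2 + spread n k) * a k)
             (smult (1/8) (dec_op (dec_op (gap2_op P))) + gap_op (spread_col_op P))"
proof -
  note sp = represents_gap[OF represents_spread_col[OF assms]]
  note dr = represents_scale[OF represents_dec[OF represents_dec[OF represents_gap2[OF assms]]],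
              of "1/8"]
  show ?thesis
    by (rule represents_cong[OF represents_add[OF dr sp]])
       (simp add: drift_def spread_def field_simps power2_eq_square)
qed

lemma represents_weight3:
  assumes "represents (\<lambda>n k. a k) P"
  shows   "represents (\<lambda>n k. (drift n k ^ 3 / 6 + drift n k * spread n k) * a k)
             (smult (1/48) (dec_op (dec_op (dec_op (gap3_op P)))) +
              smult (1/2) (dec_op (gap2_op (spread_col_op P))))"
proof -
  note sp = represents_scale[OF represents_dec[OF represents_gap2[OF
              represents_spread_col[OF assms]]], of "1/2"]
  note dr = represents_scale[OF represents_dec[OF represents_dec[OF represents_dec[OF
              represents_gap3[OF assms]]]], of "1/48"]
  show ?thesis
    by (rule represents_cong[OF represents_add[OF dr sp]])
       (simp add: drift_def spread_def field_simps power2_eq_square power3_eq_cube)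
qed

lemma represents_zero_diff:
  assumes "represents (\<lambda>n k. a k + c n k) 0" "represents c P"
  shows   "represents (\<lambda>n k. a k) (- P)"
  using represents_diff[OF assms] by simp

lemmas weight_op_defs = dec_op_def gap2_op_def gap3_op_def spread_col_op_def

text \<open>
  This lemma and the two after it solve the recursions from the coefficients of \<open>s\<close>, \<open>s\<^sup>2\<close> and
  \<open>s\<^sup>3\<close>. Each recursion expresses the next moment by the preceding ones, and all operators
  involved act on polynomials, so that the resulting polynomial is found by computation.
\<close>

lemma represents_first_moment:
  assumes "represents (\<lambda>n k. e0 k) 1"
  assumes "represents (\<lambda>n k. e1 k + drift n k * e0 k) 0"
  shows   "represents (\<lambda>n k. e1 k) [:0, 0, 1/2:]"
proof -
  have "- smult (1/2) (dec_op (gap_op 1)) = [:0, 0, 1/2:]"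
    by (simp add: weight_op_defs op_eqs one_pCons)
  thus ?thesis
    using represents_zero_diff[OF assms(2) represents_drift[OF assms(1)]] by simp
qed

lemma represents_second_moment:
  assumes "represents (\<lambda>n k. e0 k) 1" "represents (\<lambda>n k. e1 k) [:0, 0, 1/2:]"
  assumes "represents (\<lambda>n k. e2 k + (drift n k * e1 k + (drift n k ^ 2 / 2 + spread n k) * e0 k)) 0"
  shows   "represents (\<lambda>n k. e2 k) [:0, 0, 1/4, 1, 37/24, 5/8:]"
proof -
  have "- (smult (1/2) (dec_op (gap_op [:0, 0, 1/2:])) +
          (smult (1/8) (dec_op (dec_op (gap2_op 1))) + gap_op (spread_col_op 1))) =
        [:0, 0, 1/4, 1, 37/24, 5/8:]"
    by (simp add: weight_op_defs op_eqs one_pCons)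
  thus ?thesis
    using represents_zero_diff[OF assms(3) represents_add[OF represents_drift[OF assms(2)]
            represents_weight2[OF assms(1)]]] by simp
qed

lemma represents_third_moment:
  assumes "represents (\<lambda>n k. e0 k) 1" "represents (\<lambda>n k. e1 k) [:0, 0, 1/2:]"
          "represents (\<lambda>n k. e2 k) [:0, 0, 1/4, 1, 37/24, 5/8:]"
  assumes "represents (\<lambda>n k. e3 k + (drift n k * e2 k +
             ((drift n k ^ 2 / 2 + spread n k) * e1 k +
              (drift n k ^ 3 / 6 + drift n k * spread n k) * e0 k))) 0"
  shows   "represents (\<lambda>n k. e3 k) [:0, 0, 1/12, 7/6, 43/8, 12, 677/48, 395/48, 15/8:]"
proof -
  have "- (smult (1/2) (dec_op (gap_op [:0, 0, 1/4, 1, 37/24, 5/8:])) +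
          (smult (1/8) (dec_op (dec_op (gap2_op [:0, 0, 1/2:]))) + gap_op (spread_col_op [:0, 0, 1/2:]) +
          (smult (1/48) (dec_op (dec_op (dec_op (gap3_op 1)))) +
              smult (1/2) (dec_op (gap2_op (spread_col_op 1)))))) =
        [:0, 0, 1/12, 7/6, 43/8, 12, 677/48, 395/48, 15/8:]"
    by (simp add: weight_op_defs op_eqs one_pCons)
  thus ?thesis
    using represents_zero_diff[OF assms(4) represents_add[OF represents_drift[OF assms(3)]
            represents_add[OF represents_weight2[OF assms(2)] represents_weight3[OF assms(1)]]]]
    by simp
qed

lemma represents_inject:
  assumes "represents (\<lambda>n k. a k) P" "represents (\<lambda>n k. b k) P"
  shows   "a n = b n"
  using assms by (intro abel_transform_inject) (simp add: represents_def)

text \<open>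
  The sequences \<open>e0\<close>, \<dots>, \<open>e3\<close> stand for the sums of \<open>area ^ r / r!\<close>, and
  \<open>a * (a - 1) * (a - 2) = a ^ 3 - 3 * a ^ 2 + 2 * a\<close> explains the left-hand side. Both sides have the
  same transform, and the transform is injective.
\<close>

lemma third_factorial_moment_relation:
  assumes e0: "represents (\<lambda>n k. e0 k) 1" and e1: "represents (\<lambda>n k. e1 k) [:0, 0, 1/2:]"
    and e2: "represents (\<lambda>n k. e2 k) [:0, 0, 1/4, 1, 37/24, 5/8:]"
    and e3: "represents (\<lambda>n k. e3 k) [:0, 0, 1/12, 7/6, 43/8, 12, 677/48, 395/48, 15/8:]"
  shows "6 * e3 n - 6 * e2 n + 2 * e1 n =
           (- (175/192) * real n ^ 4 - (283/192) * real n ^ 3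
              + (199/192) * real n ^ 2 + (259/192) * real n) * e0 n
           + ((15/32) * real n ^ 3 + (521/96) * real n ^ 2
                 + (1219/96) * real n + 743/96) * e1 n"
proof -
  let ?e2 = "[:0, 0, 1/4, 1, 37/24, 5/8 :: real:]"
  let ?e3 = "[:0, 0, 1/12, 7/6, 43/8, 12, 677/48, 395/48, 15/8 :: real:]"
  note sc = represents_scale
  note a1 = represents_col[OF e0] note a2 = represents_col[OF a1]
  note a3 = represents_col[OF a2] note a4 = represents_col[OF a3]
  note b1 = represents_col[OF e1] note b2 = represents_col[OF b1]
  note b3 = represents_col[OF b2]
  note lhs = represents_add[OF represents_diff[OF sc[OF e3, of 6] sc[OF e2, of 6]] sc[OF e1, of 2]]
  note rhs = represents_add[OF represents_add[OF represents_add[OF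
         sc[OF a4, of "- (175/192)"] sc[OF a3, of "- (283/192)"]]
         represents_add[OF sc[OF a2, of "199/192"] sc[OF a1, of "259/192"]]]
       represents_add[OF represents_add[OF sc[OF b3, of "15/32"] sc[OF b2, of "521/96"]]
         represents_add[OF sc[OF b1, of "1219/96"] sc[OF e1, of "743/96"]]]]
  have eq: "smult 6 ?e3 - smult 6 ?e2 + smult 2 [:0, 0, 1/2:] =
     smult (- (175/192)) (col_op (col_op (col_op (col_op 1)))) +
     smult (- (283/192)) (col_op (col_op (col_op 1))) +
     (smult (199/192) (col_op (col_op 1)) + smult (259/192) (col_op 1)) +
     (smult (15/32) (col_op (col_op (col_op [:0, 0, 1/2:]))) +
      smult (521/96) (col_op (col_op [:0, 0, 1/2:])) +
      (smult (1219/96) (col_op [:0, 0, 1/2:]) + smult (743/96) [:0, 0, 1/2:]))"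
    by (simp add: op_eqs one_pCons)
  show ?thesis
    using represents_inject[OF lhs rhs[folded eq], of n]
    by (simp add: algebra_simps power2_eq_square power3_eq_cube power4_eq_xxxx)
qed


section \<open>Moments of the area\<close>

text \<open>
  This says \<open>F = c * exp (h * s + g * s\<^sup>2) + O(s\<^sup>4)\<close>. The absence of a cubic term in the logarithm
  is a symmetry: it holds for \<open>1 + exp s + \<dots> + exp (k * s)\<close>, which is \<open>exp (k * s / 2)\<close> times an even
  function.
\<close>

definition has_cumulants :: "real fps \<Rightarrow> real \<Rightarrow> real \<Rightarrow> real \<Rightarrow> bool" where
  "has_cumulants F c h g \<longleftrightarrow>
     F $ 0 = c \<and> F $ 1 = c * h \<and> F $ 2 = c * (h ^ 2 / 2 + g) \<and> F $ 3 = c * (h ^ 3 / 6 + h * g)"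

lemma fps_mult_nth_small:
  fixes F G :: "real fps"
  shows "(F * G) $ 0 = F $ 0 * G $ 0" "(F * G) $ 1 = F $ 0 * G $ 1 + F $ 1 * G $ 0"
    "(F * G) $ 2 = F $ 0 * G $ 2 + F $ 1 * G $ 1 + F $ 2 * G $ 0"
    "(F * G) $ 3 = F $ 0 * G $ 3 + F $ 1 * G $ 2 + F $ 2 * G $ 1 + F $ 3 * G $ 0"
  by (simp_all add: fps_mult_nth eval_nat_numeral)

lemma has_cumulants_mult:
  assumes "has_cumulants F c h g" "has_cumulants G d h' g'"
  shows   "has_cumulants (F * G) (c * d) (h + h') (g + g')"
proof -
  note F = assms(1)[unfolded has_cumulants_def] and G = assms(2)[unfolded has_cumulants_def]
  show ?thesis
    unfolding has_cumulants_def fps_mult_nth_small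
    by (simp only: F G) (simp add: field_simps power2_eq_square power3_eq_cube)
qed

lemma has_cumulants_exp: "has_cumulants (fps_exp a) 1 a 0"
  by (simp add: has_cumulants_def fact_numeral)

lemma has_cumulants_power:
  assumes "has_cumulants F c h g"
  shows   "has_cumulants (F ^ m) (c ^ m) (real m * h) (real m * g)"
proof (induction m)
  case 0
  thus ?case by (simp add: has_cumulants_def)
next
  case (Suc m)
  from has_cumulants_mult[OF assms this] show ?case by (simp add: algebra_simps)
qed

lemma has_cumulants_geometric:
  "has_cumulants (\<Sum>j\<le>k. fps_exp (real j)) (real k + 1) (real k / 2) (real k * (real k + 2) / 24)"
proof -
  have "(\<Sum>j\<le>k. real j) = real k * (real k + 1) / 2"
       "(\<Sum>j\<le>k. real j ^ 2) = real k * (real k + 1) * (2 * real k + 1) / 6"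
       "(\<Sum>j\<le>k. real j ^ 3) = (real k * (real k + 1) / 2) ^ 2"
    by (induction k; simp add: field_simps power2_eq_square power3_eq_cube)+
  thus ?thesis
    by (simp add: has_cumulants_def fps_sum_nth fact_numeral flip: sum_divide_distrib)
       (simp add: field_simps power2_eq_square power3_eq_cube)
qed

definition area_egf :: "nat \<Rightarrow> real fps" where
  "area_egf n = (\<Sum>p\<in>parking_functions n. fps_exp (area p))"

definition area_moment :: "nat \<Rightarrow> nat \<Rightarrow> real" where
  "area_moment r n = (\<Sum>p\<in>parking_functions n. area p ^ r) / fact r"

lemma area_egf_nth: "area_egf n $ r = area_moment r n"
  by (simp add: area_egf_def area_moment_def fps_sum_nth sum_divide_distrib)

text \<open>
  In the inversion formula this is what remains of the weight of the \<open>n - k\<close> cars outside the parking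
  function after the shift of exponents that turns the weight of parking functions into the area.
\<close>

definition complement_factor :: "nat \<Rightarrow> nat \<Rightarrow> real fps" where
  "complement_factor n k =
     fps_exp (real (n - k) * (real (n - k) - 1) / 2) * (\<Sum>j\<le>k. fps_exp (real j)) ^ (n - k)"

lemma has_cumulants_complement_factor:
  assumes "k \<le> n"
  shows   "has_cumulants (complement_factor n k) ((real k + 1) ^ (n - k)) (drift n k) (spread n k)"
proof -
  let ?m = "real (n - k)"
  have m: "?m = real n - real k" using assms by simp
  have d: "?m * (?m - 1) / 2 + ?m * (real k / 2) = drift n k"
    unfolding m drift_def by (simp add: field_simps)
  have s: "0 + ?m * (real k * (real k + 2) / 24) = spread n k"
    unfolding m spread_def by simp
  show ?thesis
    using has_cumulants_mult[OF has_cumulants_exp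
            has_cumulants_power[OF has_cumulants_geometric[of k], of "n - k"],
            of "?m * (?m - 1) / 2"]
    unfolding complement_factor_def d s by simp
qed

text \<open>
  The general inversion formula is used with the weight \<open>exp (s * (1 - v))\<close> and multiplied by
  \<open>exp (s * n * (n - 1) / 2)\<close>. The identity
  \<open>n * (n - 1) / 2 = k * (k - 1) / 2 + (n - k) * (n - k - 1) / 2 + k * (n - k)\<close> distributes the
  exponent: the first part turns the weight of a parking function into its area, the last part turns the geometric sums into sums of nonnegative powers of \<open>exp s\<close>,
  and the middle part stays as a separate factor.
\<close>

lemma area_egf_inversion:
  assumes "n > 0"
  shows   "(\<Sum>k\<le>n. of_nat (n choose k) * ((-1) ^ (n - k) * area_egf k * complement_factor n k)) = 0"
proof -
  define x where "x = (\<lambda>v. fps_exp (1 - real v))"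
  define P where "P = (\<lambda>k. \<Sum>p\<in>parking_functions k. prod_list (map x p))"
  define T where "T = (\<lambda>k. real k * (real k - 1) / 2)"
  have wt: "prod_list (map x p) = fps_exp (real (length p) - real (sum_list p))" for p
    by (induction p) (simp_all add: x_def algebra_simps flip: fps_exp_add_mult)
  have egf: "fps_exp (T k) * P k = area_egf k" for k
    unfolding P_def area_egf_def sum_distrib_left wt fps_exp_add_mult [symmetric]
    by (intro sum.cong refl arg_cong[of _ _ fps_exp])
       (auto simp: parking_functions_def area_def T_def field_simps)
  have geo: "fps_exp (real k) * (\<Sum>v=1..k + 1. x v) = (\<Sum>j\<le>k. fps_exp (real j))" for k
    unfolding sum_distrib_left x_def fps_exp_add_mult [symmetric]
    by (rule sum.reindex_bij_witness[of _ "\<lambda>j. k + 1 - j" "\<lambda>v. k + 1 - v"]) (auto simp: of_nat_diff)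
  have "0 = fps_exp (T n) * (\<Sum>k\<le>n. of_nat (n choose k) *
              (P k * (-1) ^ (n - k) * (\<Sum>v=1..k + 1. x v) ^ (n - k)))"
    unfolding P_def parking_function_inversion[OF assms] by simp
  also have "\<dots> = (\<Sum>k\<le>n. of_nat (n choose k) * ((-1) ^ (n - k) * area_egf k * complement_factor n k))"
    unfolding sum_distrib_left
  proof (intro sum.cong refl)
    fix k assume "k \<in> {..n}"
    hence "real (n - k) = real n - real k" by simp
    hence "T n = T k + T (n - k) + real (n - k) * real k"
      by (simp add: T_def field_simps)
    hence "fps_exp (T n) = fps_exp (T k) * fps_exp (T (n - k)) * fps_exp (real k) ^ (n - k)"
      by (simp add: fps_exp_add_mult fps_exp_power_mult)
    moreover have "complement_factor n k =
        fps_exp (T (n - k)) * (fps_exp (real k) ^ (n - k) * (\<Sum>v=1..k + 1. x v) ^ (n - k))"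
      by (simp only: complement_factor_def T_def geo [symmetric] power_mult_distrib)
    ultimately show "fps_exp (T n) * (of_nat (n choose k) * (P k * (-1) ^ (n - k) * (\<Sum>v=1..k + 1. x v) ^ (n - k))) =
          of_nat (n choose k) * ((-1) ^ (n - k) * area_egf k * complement_factor n k)"
      by (simp only: egf [symmetric] mult_ac)
  qed
  finally show ?thesis by simp
qed

text \<open>
  If the \<open>r\<close>-th coefficients have this product form, the coefficient of \<open>s ^ r\<close> in the inversion
  formula is \<open>n!\<close> times a coefficient of an Abel sum.
\<close>

lemma abel_sum_nth_eq_0:
  assumes B: "\<And>k. k \<le> n \<Longrightarrow> (area_egf k * complement_factor n k) $ r = (real k + 1) ^ (n - k) * c n k"
    and "n > 0"
  shows "abel_sum c $ n = 0"
proof -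
  have neg1: "(-1 :: real fps) ^ m = fps_const ((-1) ^ m)" for m
    by (induction m) auto
  have "0 = (\<Sum>k\<le>n. of_nat (n choose k) * ((-1) ^ (n - k) * area_egf k * complement_factor n k)) $ r"
    using area_egf_inversion[OF assms(2)] by simp
  also have "\<dots> = (\<Sum>k\<le>n. real (n choose k) * ((-1) ^ (n - k) * ((real k + 1) ^ (n - k) * c n k)))"
    unfolding fps_sum_nth
    by (intro sum.cong refl)
       (simp add: B neg1 mult.assoc flip: fps_of_nat)
  also have "\<dots> = fact n * abel_sum c $ n"
    unfolding abel_sum_nth sum_distrib_left
  proof (intro sum.cong refl)
    fix k assume "k \<in> {..n}"
    moreover have "(- (real k + 1)) ^ (n - k) = (-1) ^ (n - k) * (real k + 1) ^ (n - k)"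
      by (rule power_minus)
    ultimately show "real (n choose k) * ((-1) ^ (n - k) * ((real k + 1) ^ (n - k) * c n k)) =
        fact n * (c n k * (- (real k + 1)) ^ (n - k) / (fact k * fact (n - k)))"
      by (simp add: binomial_fact)
  qed
  finally show ?thesis by simp
qed

lemma parking_functions_0: "parking_functions 0 = {[]}"
  by (auto simp: parking_functions_def)

lemma area_moment_at_0: "area_moment r 0 = (if r = 0 then 1 else 0)"
  by (simp add: area_moment_def parking_functions_0 area_def)

text \<open>
  In order 0 the inversion formula says that the Abel transform of the number of parking functions
  vanishes in positive degrees.
\<close>

lemma represents_area_moment_0: "represents (\<lambda>n k. area_moment 0 k) 1"
  unfolding represents_def
proof (rule fps_ext)
  fix n
  show "abel_transform (area_moment 0) $ n = eval_geom 1 $ n"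
  proof (cases "n > 0")
    case True
    have "abel_transform (area_moment 0) $ n = 0"
      by (rule abel_sum_nth_eq_0[of n 0])
         (use True has_cumulants_complement_factor in
           \<open>auto simp: fps_mult_nth_small area_egf_nth has_cumulants_def\<close>)
    with True show ?thesis by simp
  qed (simp add: abel_sum_nth area_moment_at_0)
qed

lemma represents_0I:
  assumes B: "\<And>n k. k \<le> n \<Longrightarrow> (area_egf k * complement_factor n k) $ r = (real k + 1) ^ (n - k) * c n k"
    and "c 0 0 = 0"
  shows "represents c 0"
  unfolding represents_def
proof (rule fps_ext)
  fix n
  show "abel_sum c $ n = eval_geom 0 $ n"
    using abel_sum_nth_eq_0[of n r c] assms by (cases "n = 0") (auto simp: abel_sum_nth)
qed

lemma represents_area_moment_1: "represents (\<lambda>n k. area_moment 1 k) [:0, 0, 1/2:]"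
proof (rule represents_first_moment[OF represents_area_moment_0])
  show "represents (\<lambda>n k. area_moment 1 k + drift n k * area_moment 0 k) 0"
  proof (rule represents_0I[of 1], goal_cases)
    case (1 n k)
    note cumulants = has_cumulants_complement_factor[OF 1, unfolded has_cumulants_def]
    show ?case
      unfolding fps_mult_nth_small area_egf_nth
      by (simp only: cumulants) (simp add: algebra_simps)
  qed (simp add: area_moment_at_0 drift_def)
qed

lemma represents_area_moment_2:
  "represents (\<lambda>n k. area_moment 2 k) [:0, 0, 1/4, 1, 37/24, 5/8:]"
proof (rule represents_second_moment[OF represents_area_moment_0 represents_area_moment_1])
  show "represents (\<lambda>n k. area_moment 2 k + (drift n k * area_moment 1 k +
          (drift n k ^ 2 / 2 + spread n k) * area_moment 0 k)) 0"
  proof (rule represents_0I[of 2], goal_cases)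
    case (1 n k)
    note cumulants = has_cumulants_complement_factor[OF 1, unfolded has_cumulants_def]
    show ?case
      unfolding fps_mult_nth_small area_egf_nth
      by (simp only: cumulants) (simp add: algebra_simps)
  qed (simp add: area_moment_at_0 drift_def spread_def)
qed

lemma represents_area_moment_3:
  "represents (\<lambda>n k. area_moment 3 k) [:0, 0, 1/12, 7/6, 43/8, 12, 677/48, 395/48, 15/8:]"
proof (rule represents_third_moment[OF represents_area_moment_0 represents_area_moment_1
         represents_area_moment_2])
  show "represents (\<lambda>n k. area_moment 3 k + (drift n k * area_moment 2 k +
          ((drift n k ^ 2 / 2 + spread n k) * area_moment 1 k +
           (drift n k ^ 3 / 6 + drift n k * spread n k) * area_moment 0 k))) 0"
  proof (rule represents_0I[of 3], goal_cases)
    case (1 n k)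
    note cumulants = has_cumulants_complement_factor[OF 1, unfolded has_cumulants_def]
    show ?case
      unfolding fps_mult_nth_small area_egf_nth
      by (simp only: cumulants) (simp add: algebra_simps)
  qed (simp add: area_moment_at_0 drift_def spread_def)
qed

lemma card_parking_functions: "area_moment 0 n = real (card (parking_functions n))"
  by (simp add: area_moment_def)

lemma area_moment_0_pos: "area_moment 0 n > 0"
  using finite_parking_functions[of n] parking_functions_nonempty[of n]
  by (simp add: card_parking_functions card_gt_0_iff)

lemma expectation_parking_function:
  "measure_pmf.expectation (random_parking_function n) f =
     (\<Sum>p\<in>parking_functions n. f p) / area_moment 0 n"
  by (simp add: random_parking_function_def card_parking_functions
        integral_pmf_of_set[OF parking_functions_nonempty finite_parking_functions])

lemma expected_area_eq: "expected_area n = area_moment 1 n / area_moment 0 n"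
  by (simp add: expected_area_def expectation_parking_function) (simp add: area_moment_def)

lemma area_factorial_moment_3_eq:
  "area_factorial_moment 3 n =
     (6 * area_moment 3 n - 6 * area_moment 2 n + 2 * area_moment 1 n) / area_moment 0 n"
proof -
  have "(\<Prod>i<3. a - real i) = a ^ 3 - 3 * a ^ 2 + 2 * a ^ 1" for a :: real
    by (simp add: eval_nat_numeral algebra_simps)
  hence "(\<Sum>p\<in>parking_functions n. \<Prod>i<3. area p - real i) =
         6 * area_moment 3 n - 6 * area_moment 2 n + 2 * area_moment 1 n"
    by (simp add: area_moment_def sum.distrib sum_subtractf sum_distrib_left [symmetric] fact_numeral)
  thus ?thesis by (simp add: area_factorial_moment_def expectation_parking_function)
qed

theorem area_factorial_moment_3:
  "area_factorial_moment 3 n =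
     - (175/192) * real n ^ 4 - (283/192) * real n ^ 3
     + (199/192) * real n ^ 2 + (259/192) * real n
     + ((15/32) * real n ^ 3 + (521/96) * real n ^ 2
        + (1219/96) * real n + 743/96) * expected_area n"
proof -
  note rel = third_factorial_moment_relation[OF represents_area_moment_0 represents_area_moment_1
               represents_area_moment_2 represents_area_moment_3, of n]
  show ?thesis
    unfolding area_factorial_moment_3_eq expected_area_eq rel add_divide_distrib
    using area_moment_0_pos[of n] by simp
qed


section \<open>The expected area and Ramanujan's Q-function\<close>

text \<open>
  The sum is \<open>M!\<close> times the coefficient of \<open>s ^ M\<close> in \<open>exp (a * s) * (exp s - 1) ^ M\<close>, a series
  that starts with \<open>s ^ M\<close>.
\<close>

lemma finite_difference_power:
  "(\<Sum>i\<le>M. real (M choose i) * (-1) ^ (M - i) * (real i + a) ^ M) = fact M"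
proof -
  let ?E = "fps_exp (1 :: real)"
  have "fps_exp a * (?E + (-1)) ^ M =
        (\<Sum>i\<le>M. fps_const (real (M choose i) * (-1) ^ (M - i)) * fps_exp (real i + a))"
  proof -
    have c: "(-1 :: real fps) ^ j = fps_const ((-1) ^ j)" for j
      by (induction j) auto
    show ?thesis
      unfolding binomial_ring sum_distrib_left
      by (intro sum.cong refl)
         (simp add: fps_exp_power_mult fps_exp_add_mult c fps_of_nat [symmetric] mult_ac
               flip: fps_const_mult)
  qed
  hence "(fps_exp a * (?E - 1) ^ M) $ M =
         (\<Sum>i\<le>M. real (M choose i) * (-1) ^ (M - i) * (real i + a) ^ M) / fact M"
    by (simp add: fps_sum_nth sum_divide_distrib)
  moreover have "(fps_exp a * (?E - 1) ^ M) $ M = 1"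
  proof -
    define G :: "real fps" where "G = fps_shift 1 (?E - 1)"
    have "?E - 1 = fps_X * G"
      unfolding G_def by (rule fps_ext) (simp add: fps_X_mult_nth split: if_splits)
    hence eq: "fps_exp a * (?E - 1) ^ M = fps_X ^ M * (fps_exp a * G ^ M)"
      by (simp add: power_mult_distrib mult_ac)
    have "G $ 0 = 1" by (simp add: G_def)
    thus ?thesis unfolding eq by (simp add: fps_X_power_mult_nth fps_power_zeroth)
  qed
  ultimately show ?thesis by (simp add: field_simps)
qed

text \<open>
  These are the sequences with transform \<open>z ^ j / (1 - z)\<close>; in terms of Cayley's tree function \<open>T\<close>
  their exponential generating functions are \<open>T ^ j * exp T / (1 - T)\<close>.
\<close>

definition tree_seq :: "nat \<Rightarrow> nat \<Rightarrow> real" where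
  "tree_seq j k = (if j \<le> k then fact k / fact (k - j) * (real k + 1) ^ (k - j) else 0)"

lemma abel_transform_tree_seq: "abel_transform (tree_seq j) $ n = (if j \<le> n then 1 else 0)"
proof (cases "j \<le> n")
  case True
  define M where "M = n - j"
  have "abel_transform (tree_seq j) $ n =
        (\<Sum>k\<in>{j..n}. tree_seq j k * (- (real k + 1)) ^ (n - k) / (fact k * fact (n - k)))"
    unfolding abel_sum_nth by (intro sum.mono_neutral_right) (auto simp: tree_seq_def)
  also have "\<dots> = (\<Sum>i\<le>M. real (M choose i) * (-1) ^ (M - i) * (real i + (real j + 1)) ^ M / fact M)"
  proof (rule sum.reindex_bij_witness[of _ "\<lambda>i. i + j" "\<lambda>k. k - j"])
    fix k assume k: "k \<in> {j..n}"
    then obtain i where i: "k = j + i" "i \<le> M" by (auto simp: M_def le_iff_add)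
    have n: "n = j + M" using True by (simp add: M_def)
    define r where "r = real k + 1"
    have "r ^ M = r ^ i * r ^ (M - i)"
      using i by (simp flip: power_add)
    moreover have "(- r) ^ (M - i) = (-1) ^ (M - i) * r ^ (M - i)"
      by (rule power_minus)
    moreover have "real i + (real j + 1) = r" "n - k = M - i" "k - j = i"
        "tree_seq j k = fact k / fact i * r ^ i"
      using i n by (auto simp: r_def tree_seq_def)
    ultimately show "real (M choose (k - j)) * (-1) ^ (M - (k - j)) * (real (k - j) + (real j + 1)) ^ M / fact M =
          tree_seq j k * (- (real k + 1)) ^ (n - k) / (fact k * fact (n - k))"
      using i(2) by (simp add: binomial_fact flip: r_def)
  qed (use True in \<open>auto simp: M_def\<close>)
  also have "\<dots> = 1"
    by (simp only: sum_divide_distrib [symmetric] finite_difference_power) simp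
  finally show ?thesis using True by simp
qed (auto simp: abel_sum_nth tree_seq_def)

text \<open>
  This is Cayley's count \<open>(n + 1) ^ (n - 1)\<close>, stated without division and without a truncated
  exponent.
\<close>

lemma zeroth_moment_eq:
  assumes "represents (\<lambda>n k. e0 k) 1"
  shows   "(real n + 1) * e0 n = (real n + 1) ^ n"
proof -
  have "abel_transform (\<lambda>k. (real k + 1) * e0 k) = 1 + geom"
    using assms unfolding represents_def abel_transform_Suc by simp
  also have "1 + geom = abel_transform (tree_seq 0)"
    by (simp add: fps_eq_iff abel_transform_tree_seq geom_nth)
  finally show ?thesis using abel_transform_inject by (fastforce simp: tree_seq_def)
qed

text \<open>
  Ramanujan's function is usually defined by the sum from \<open>i = 1\<close> on. Starting at \<open>i = 0\<close> adds 1 to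
  it and makes the integral representation below hold without a correction.
\<close>

definition ramanujan_Q :: "nat \<Rightarrow> real" where
  "ramanujan_Q N = (\<Sum>i\<le>N. fact N / fact (N - i) / real N ^ i)"

text \<open>
  The transform of the first moment is \<open>(z / (1 - z))\<^sup>2 / 2\<close>, half the sum of
  \<open>z ^ j / (1 - z)\<close> over all \<open>j \<ge> 2\<close>, and \<open>tree_seq j\<close> inverts each summand.
\<close>

lemma area_moment_1_eq: "area_moment 1 n = (\<Sum>j=2..n. tree_seq j n) / 2"
proof (rule represents_inject[OF represents_area_moment_1])
  show "represents (\<lambda>n k. (\<Sum>j=2..k. tree_seq j k) / 2) [:0, 0, 1/2:]"
    unfolding represents_def
  proof (rule fps_ext)
    fix n
    have geom_square: "geom * geom = fps_X * fps_deriv geom - geom"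
      by (simp add: X_deriv_geom algebra_simps)
    have "[:0, 0, 1/2 :: real:] = smult (1/2) ([:0, 1:] * [:0, 1:])" by simp
    hence half_square: "eval_geom [:0, 0, 1/2:] = fps_const (1/2) * (geom * geom)"
      by (simp only: eval_geom_smult eval_geom_mult eval_geom_simps)
    have "abel_transform (\<lambda>k. (\<Sum>j=2..k. tree_seq j k) / 2) $ n =
          abel_transform (\<lambda>k. (\<Sum>j=2..n. tree_seq j k) / 2) $ n"
      unfolding abel_sum_nth
    proof (intro sum.cong refl)
      fix k assume "k \<in> {..n}"
      hence "(\<Sum>j=2..k. tree_seq j k) = (\<Sum>j=2..n. tree_seq j k)"
        by (intro sum.mono_neutral_left) (auto simp: tree_seq_def)
      thus "(\<Sum>j=2..k. tree_seq j k) / 2 * (- (real k + 1)) ^ (n - k) / (fact k * fact (n - k)) =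
            (\<Sum>j=2..n. tree_seq j k) / 2 * (- (real k + 1)) ^ (n - k) / (fact k * fact (n - k))"
        by simp
    qed
    also have "\<dots> = (\<Sum>j=2..n. abel_transform (tree_seq j) $ n) / 2"
    proof -
      have "abel_transform (\<lambda>k. (\<Sum>j=2..n. tree_seq j k) / 2) $ n =
            (\<Sum>k\<le>n. \<Sum>j=2..n. tree_seq j k * (- (real k + 1)) ^ (n - k) / (fact k * fact (n - k)) / 2)"
        unfolding abel_sum_nth sum_divide_distrib sum_distrib_right
        by (intro sum.cong refl) simp
      also have "\<dots> = (\<Sum>j=2..n. abel_transform (tree_seq j) $ n) / 2"
        unfolding abel_sum_nth sum_divide_distrib by (rule sum.swap)
      finally show ?thesis .
    qed
    also have "\<dots> = (real n - 1) / 2 + (if n = 0 then 1 / 2 else 0)"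
      by (cases n) (simp_all add: abel_transform_tree_seq)
    also have "\<dots> = eval_geom [:0, 0, 1/2:] $ n"
      unfolding half_square geom_square by (cases n) (simp_all add: geom_nth)
    finally show "abel_transform (\<lambda>k. (\<Sum>j=2..k. tree_seq j k) / 2) $ n = eval_geom [:0, 0, 1/2:] $ n" .
  qed
qed

text \<open>
  With \<open>N = n + 1\<close>, the summands \<open>tree_seq j n\<close> become the summands of \<open>ramanujan_Q N\<close> of index
  \<open>j + 1 \<ge> 3\<close>. The omitted summands of index 0, 1 and 2 add up to \<open>3 - 1 / N\<close>.
\<close>

lemma expected_area_ramanujan_Q:
  assumes "n \<ge> 1"
  shows   "expected_area n = ((real n + 1) * (ramanujan_Q (n + 1) - 3) + 1) / 2"
proof -
  define N where "N = n + 1"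
  have N: "N \<ge> 2" "real n + 1 = real N" "real N > 0" using assms by (auto simp: N_def)
  have m0: "real N * area_moment 0 n = real N ^ n"
    using zeroth_moment_eq[OF represents_area_moment_0, of n] by (simp add: N)
  have "expected_area n = real N * area_moment 1 n / (real N * area_moment 0 n)"
    using N by (simp add: expected_area_eq)
  also have "\<dots> = real N / 2 * (\<Sum>j=2..n. tree_seq j n / real N ^ n)"
    unfolding m0 area_moment_1_eq by (simp flip: sum_divide_distrib)
  also have "(\<Sum>j=2..n. tree_seq j n / real N ^ n) = (\<Sum>i=3..N. fact N / fact (N - i) / real N ^ i)"
  proof (rule sum.reindex_bij_witness[of _ "\<lambda>i. i - 1" "\<lambda>j. j + 1"])
    fix j assume j: "j \<in> {2..n}"
    hence "real N ^ n = real N ^ (n - j) * real N ^ j" by (simp flip: power_add)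
    thus "fact N / fact (N - (j + 1)) / real N ^ (j + 1) = tree_seq j n / real N ^ n"
      using j N by (simp add: tree_seq_def N_def divide_simps add.commute)
  qed (auto simp: N_def)
  also have "ramanujan_Q N = (\<Sum>i\<in>{0,1,2} \<union> {3..N}. fact N / fact (N - i) / real N ^ i)"
    unfolding ramanujan_Q_def using N by (intro sum.cong) auto
  hence "(\<Sum>i=3..N. fact N / fact (N - i) / real N ^ i) =
         ramanujan_Q N - (\<Sum>i\<in>{0,1,2}. fact N / fact (N - i) / real N ^ i)"
    by (subst (asm) sum.union_disjoint) auto
  also have "(\<Sum>i\<in>{0,1,2}. fact N / fact (N - i) / real N ^ i) = 3 - 1 / real N"
  proof -
    obtain M where M: "N = Suc (Suc M)" using N(1) by (metis le_Suc_ex add_2_eq_Suc)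
    show ?thesis by (simp add: M power2_eq_square divide_simps)
  qed
  also have "real N / 2 * (ramanujan_Q N - (3 - 1 / real N)) = (real N * (ramanujan_Q N - 3) + 1) / 2"
    using N(3) by (simp add: field_simps)
  finally show ?thesis unfolding N(2) N_def .
qed

section \<open>Estimates for Ramanujan's Q-function\<close>

lemma half_gaussian_integral:
  fixes a :: real
  assumes "a > 0"
  shows   "has_bochner_integral lborel (\<lambda>x. indicator {0..} x * exp (- (x ^ 2 / a))) (sqrt (pi * a) / 2)"
proof -
  define c where "c = 1 / sqrt a"
  have c: "c > 0" "c ^ 2 = 1 / a" using assms by (auto simp: c_def power_divide)
  have "has_bochner_integral lborel (\<lambda>x. indicator {0..} (0 + c * x) *\<^sub>R exp (- (0 + c * x)\<^sup>2))
          ((sqrt pi / 2) /\<^sub>R \<bar>c\<bar>)"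
    using lborel_has_bochner_integral_real_affine_iff[of c
            "\<lambda>x. indicator {0..} x *\<^sub>R exp (- x\<^sup>2)" "sqrt pi / 2" 0] gaussian_moment_0 c
    by simp
  also have "(\<lambda>x. indicator {0..} (0 + c * x) *\<^sub>R exp (- (0 + c * x)\<^sup>2)) =
             (\<lambda>x. indicator {0..} x * exp (- (x ^ 2 / a)))"
    using c by (auto simp: fun_eq_iff indicator_def power_mult_distrib zero_le_mult_iff)
  also have "(sqrt pi / 2) /\<^sub>R \<bar>c\<bar> = sqrt (pi * a) / 2"
    using assms by (simp add: c_def real_sqrt_mult field_simps)
  finally show ?thesis .
qed

lemma power_exp_integral:
  "has_bochner_integral lborel (\<lambda>x. indicator {0..} x * (x ^ k * exp (- x))) (fact k :: real)"
proof (rule has_bochner_integral_nn_integral)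
  have "(\<integral>\<^sup>+x. ennreal (indicator {0..} x * (x ^ k * exp (- x))) \<partial>lborel) =
        (\<integral>\<^sup>+x. ennreal (x ^ k * exp (- x)) * indicator {0..} x \<partial>lborel)"
    by (intro nn_integral_cong) (auto simp: indicator_def)
  thus "(\<integral>\<^sup>+x. ennreal (indicator {0..} x * (x ^ k * exp (- x))) \<partial>lborel) = ennreal (fact k)"
    by (simp add: nn_intergal_power_times_exp_Ici)
qed (auto simp: indicator_def)

text \<open>
  Expanding the power by the binomial theorem leaves Gamma integrals with values \<open>i!\<close>.
\<close>

lemma ramanujan_Q_integral:
  assumes "N > 0"
  shows   "has_bochner_integral lborel
             (\<lambda>x. indicator {0..} x * (exp (- x) * (1 + x / real N) ^ N)) (ramanujan_Q N)"
proof -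
  have "has_bochner_integral lborel
          (\<lambda>x. \<Sum>i\<le>N. (real (N choose i) / real N ^ i) * (indicator {0..} x * (x ^ i * exp (- x))))
          (\<Sum>i\<le>N. (real (N choose i) / real N ^ i) * fact i)"
    by (intro has_bochner_integral_sum has_bochner_integral_mult_right power_exp_integral)
  also have "(\<Sum>i\<le>N. (real (N choose i) / real N ^ i) * fact i) = ramanujan_Q N"
    unfolding ramanujan_Q_def by (intro sum.cong refl) (simp add: binomial_fact)
  also have "(\<lambda>x. \<Sum>i\<le>N. (real (N choose i) / real N ^ i) * (indicator {0..} x * (x ^ i * exp (- x)))) =
             (\<lambda>x. indicator {0..} x * (exp (- x) * (1 + x / real N) ^ N))"
  proof
    fix x :: real
    have "(1 + x / real N) ^ N = (\<Sum>i\<le>N. real (N choose i) * (x / real N) ^ i)"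
      using binomial_ring[of "x / real N" 1 N] by (simp add: add.commute)
    thus "(\<Sum>i\<le>N. (real (N choose i) / real N ^ i) * (indicator {0..} x * (x ^ i * exp (- x)))) =
          indicator {0..} x * (exp (- x) * (1 + x / real N) ^ N)"
      by (simp add: sum_distrib_left power_divide mult_ac)
  qed
  finally show ?thesis .
qed

lemma exp_minus_half_square_le:
  fixes t :: real
  assumes "t \<ge> 0"
  shows   "exp (t - t ^ 2 / 2) \<le> 1 + t"
proof -
  let ?f = "\<lambda>t :: real. ln (1 + t) - t + t ^ 2 / 2"
  have "?f 0 \<le> ?f t"
  proof (rule DERIV_nonneg_imp_nondecreasing[OF assms])
    fix u :: real assume u: "0 \<le> u" "u \<le> t"
    have "(?f has_real_derivative (u ^ 2 / (1 + u))) (at u)"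
      using u by (auto intro!: derivative_eq_intros simp: divide_simps power2_eq_square algebra_simps)
    thus "\<exists>y. (?f has_real_derivative y) (at u) \<and> 0 \<le> y" using u by auto
  qed
  hence "t - t ^ 2 / 2 \<le> ln (1 + t)" by simp
  hence "exp (t - t ^ 2 / 2) \<le> exp (ln (1 + t))" by (simp only: exp_le_cancel_iff)
  thus ?thesis using assms by simp
qed

text \<open>
  With \<open>t = x / N\<close>, the bound \<open>exp (t - t\<^sup>2 / 2) \<le> 1 + t\<close> puts the integrand of
  \<open>ramanujan_Q_integral\<close> above \<open>exp (- x\<^sup>2 / (2 * N))\<close>.
\<close>

lemma ramanujan_Q_lower:
  assumes "N > 0"
  shows   "sqrt (pi * (2 * real N)) / 2 \<le> ramanujan_Q N"
proof -
  let ?f = "\<lambda>x. indicator {0..} x * exp (- (x ^ 2 / (2 * real N)))"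
  let ?g = "\<lambda>x. indicator {0..} x * (exp (- x) * (1 + x / real N) ^ N)"
  have f: "has_bochner_integral lborel ?f (sqrt (pi * (2 * real N)) / 2)"
    using assms by (intro half_gaussian_integral) simp
  note g = ramanujan_Q_integral[OF assms]
  have "exp (- (x ^ 2 / (2 * real N))) \<le> exp (- x) * (1 + x / real N) ^ N" if "x \<ge> 0" for x :: real
  proof -
    define t where "t = x / real N"
    have "exp (t - t ^ 2 / 2) ^ N \<le> (1 + t) ^ N"
      using that by (intro power_mono exp_minus_half_square_le) (auto simp: t_def)
    hence "exp (- x) * exp (real N * (t - t ^ 2 / 2)) \<le> exp (- x) * (1 + t) ^ N"
      by (simp add: exp_of_nat_mult)
    moreover have "- x + real N * (t - t ^ 2 / 2) = - (x ^ 2 / (2 * real N))"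
      using assms by (simp add: t_def field_simps power2_eq_square)
    ultimately show ?thesis by (simp add: t_def flip: exp_add)
  qed
  hence "?f x \<le> ?g x" for x :: real
    by (auto simp: indicator_def)
  hence "integral\<^sup>L lborel ?f \<le> integral\<^sup>L lborel ?g"
    using f g unfolding has_bochner_integral_iff by (intro integral_mono) blast+
  thus ?thesis using f g unfolding has_bochner_integral_iff by (elim conjE) (simp only:)
qed

text \<open>
  The left-hand side is the product of \<open>1 - j / N\<close> over \<open>j < i\<close>, and each factor is at most
  \<open>exp (- j / N)\<close>.
\<close>

lemma falling_factorial_le_gaussian:
  assumes "i \<le> N" "N > 0"
  shows   "fact N / fact (N - i) / real N ^ i \<le> exp (- (real i * (real i - 1) / (2 * real N)))"
  using assms(1)
proof (induction i)
  case (Suc i)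
  let ?t = "\<lambda>i. fact N / fact (N - i) / real N ^ i"
  have "N - i = Suc (N - Suc i)" using Suc.prems by simp
  hence "?t (Suc i) = ?t i * ((real N - real i) / real N)"
    using Suc.prems assms(2) by (simp add: divide_simps of_nat_diff)
  also have "(real N - real i) / real N = 1 + (- (real i / real N))"
    using assms(2) by (simp add: divide_simps)
  also have "?t i * \<dots> \<le>
             exp (- (real i * (real i - 1) / (2 * real N))) * exp (- (real i / real N))"
    using Suc assms(2)
    by (intro mult_mono exp_ge_add_one_self) (auto simp: divide_simps)
  also have "\<dots> = exp (- (real (Suc i) * (real (Suc i) - 1) / (2 * real N)))"
    using assms(2) by (simp add: field_simps flip: exp_add)
  finally show ?case .
qed simp

lemma gaussian_sum_le:
  fixes a :: real
  assumes "a > 0"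
  shows   "(\<Sum>k\<le>M. exp (- (real k ^ 2 / a))) \<le> 1 + sqrt (pi * a) / 2"
proof -
  let ?f = "\<lambda>x :: real. exp (- (x ^ 2 / a))"
  interpret antimono_fun_sum_integral_diff ?f
    by unfold_locales
       (use assms in \<open>auto intro!: continuous_intros divide_right_mono power_mono\<close>)
  have "(\<Sum>k\<le>M. ?f (real k)) - integral {0..real M} ?f \<le> 1"
    using sum_integral_diff_series_antimono[of 0 M] by (simp add: sum_integral_diff_series_def)
  moreover have "integral {0..real M} ?f \<le> sqrt (pi * a) / 2"
  proof (rule has_integral_le)
    have int: "integrable lborel (\<lambda>x. indicator {0..} x * ?f x)"
        "integral\<^sup>L lborel (\<lambda>x. indicator {0..} x * ?f x) = sqrt (pi * a) / 2"
      using half_gaussian_integral[OF assms] unfolding has_bochner_integral_iff by blast+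
    show "((\<lambda>x. indicator {0..} x * ?f x) has_integral sqrt (pi * a) / 2) UNIV"
      using has_integral_integral_lborel[OF int(1)] unfolding int(2) .
    have "(?f has_integral integral {0..real M} ?f) {0..real M}"
      by (intro integrable_integral integrable_continuous_real continuous_intros) (use assms in auto)
    thus "((\<lambda>x. if x \<in> {0..real M} then ?f x else 0) has_integral integral {0..real M} ?f) UNIV"
      by (subst has_integral_restrict_UNIV)
  qed (auto simp: indicator_def)
  ultimately show ?thesis by simp
qed

text \<open>
  The summand of index \<open>i + 1\<close> is at most \<open>exp (- i * (i + 1) / (2 * N)) \<le> exp (- i\<^sup>2 / (2 * N))\<close>.
\<close>

lemma ramanujan_Q_upper:
  assumes "N > 0"
  shows   "ramanujan_Q N \<le> 2 + sqrt (pi * (2 * real N)) / 2"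
proof -
  obtain M where M: "N = Suc M" using assms by (cases N) auto
  let ?t = "\<lambda>i. fact N / fact (N - i) / real N ^ i"
  have "ramanujan_Q N = 1 + (\<Sum>i\<le>M. ?t (Suc i))"
    unfolding ramanujan_Q_def M by (subst sum.atMost_Suc_shift) simp
  also have "(\<Sum>i\<le>M. ?t (Suc i)) \<le> (\<Sum>i\<le>M. exp (- (real i ^ 2 / (2 * real N))))"
  proof (rule sum_mono)
    fix i assume "i \<in> {..M}"
    hence "?t (Suc i) \<le> exp (- (real (Suc i) * (real (Suc i) - 1) / (2 * real N)))"
      by (intro falling_factorial_le_gaussian) (auto simp: M)
    also have "\<dots> \<le> exp (- (real i ^ 2 / (2 * real N)))"
      by (auto intro!: divide_right_mono simp: power2_eq_square algebra_simps)
    finally show "?t (Suc i) \<le> exp (- (real i ^ 2 / (2 * real N)))" .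
  qed
  also have "\<dots> \<le> 1 + sqrt (pi * (2 * real N)) / 2"
    by (rule gaussian_sum_le) (use assms in simp)
  finally show ?thesis by simp
qed

section \<open>The third factorial moment\<close>

lemma expected_area_error:
  assumes "n \<ge> 1"
  shows   "\<bar>expected_area n - sqrt (2 * pi) * ((real n + 1) * sqrt (real n + 1) / 4)\<bar> \<le>
             3 / 2 * (real n + 1)"
proof -
  define N where "N = n + 1"
  define s where "s = sqrt (pi * (2 * real N)) / 2"
  have N: "N > 0" "real n + 1 = real N" by (auto simp: N_def)
  have s: "s = sqrt (2 * pi) * sqrt (real N) / 2"
    by (simp add: s_def real_sqrt_mult)
  have "expected_area n - sqrt (2 * pi) * ((real n + 1) * sqrt (real n + 1) / 4) =
        real N / 2 * (ramanujan_Q N - s) - 3 / 2 * real N + 1 / 2"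
    unfolding expected_area_ramanujan_Q[OF assms] N(2) N_def [symmetric] s
    by (simp add: field_simps)
  moreover have "0 \<le> real N / 2 * (ramanujan_Q N - s)" "real N / 2 * (ramanujan_Q N - s) \<le> real N / 2 * 2"
    using ramanujan_Q_lower[OF N(1)] ramanujan_Q_upper[OF N(1)]
    by (auto simp: s_def intro!: mult_left_mono)
  moreover have "real N \<ge> 1" using N(1) by simp
  ultimately show ?thesis unfolding N(2) by linarith
qed

text \<open>
  In the exact formula the polynomial part is \<open>O(n ^ 4)\<close>, and so is the cubic coefficient times the
  linear error of the mean. What remains is \<open>15/32 * n ^ 3\<close> times \<open>sqrt (2 * pi) / 4 * n powr (3/2)\<close>,
  up to terms of order \<open>n powr (7/2)\<close>.
\<close>

lemma area_factorial_moment_3_asymptotics: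
  "(\<lambda>n. area_factorial_moment 3 n - (15/128) * sqrt (2 * pi) * real n powr (9/2))
     \<in> O(\<lambda>n. real n ^ 4)"
proof -
  let ?p = "\<lambda>n. - (175/192) * real n ^ 4 - (283/192) * real n ^ 3
              + (199/192) * real n ^ 2 + (259/192) * real n"
  let ?q = "\<lambda>n. (15/32) * real n ^ 3 + (521/96) * real n ^ 2 + (1219/96) * real n + 743/96"
  let ?m = "\<lambda>n. (real n + 1) * sqrt (real n + 1) / 4"
  let ?err = "\<lambda>n. expected_area n - sqrt (2 * pi) * ?m n"
  have "?err \<in> O(\<lambda>n. real n + 1)"
    using expected_area_error
    by (intro bigoI[of _ "3/2"] eventually_at_top_linorderI[of 1]) auto
  also have "(\<lambda>n. real n + 1) \<in> O(\<lambda>n. real n)" by real_asymp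
  finally have err: "?err \<in> O(\<lambda>n. real n)" .
  have "?q \<in> O(\<lambda>n. real n ^ 3)" by real_asymp
  from landau_o.big.mult[OF this err] have main: "(\<lambda>n. ?q n * ?err n) \<in> O(\<lambda>n. real n ^ 4)"
    by (simp add: eval_nat_numeral mult_ac)
  have poly: "?p \<in> O(\<lambda>n. real n ^ 4)" by real_asymp
  have "(\<lambda>n. ?q n * ?m n - 15/128 * real n powr (9/2)) \<in> O(\<lambda>n. real n ^ 4)"
    by real_asymp
  hence leading: "(\<lambda>n. sqrt (2 * pi) * (?q n * ?m n - 15/128 * real n powr (9/2))) \<in> O(\<lambda>n. real n ^ 4)"
    by simp
  have "(\<lambda>n. ?p n + ?q n * ?err n +
      sqrt (2 * pi) * (?q n * ?m n - 15/128 * real n powr (9/2))) \<in> O(\<lambda>n. real n ^ 4)"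
    by (rule sum_in_bigo(1)[OF sum_in_bigo(1)[OF poly main] leading])
  also have "(\<lambda>n. ?p n + ?q n * ?err n + sqrt (2 * pi) * (?q n * ?m n - 15/128 * real n powr (9/2))) =
      (\<lambda>n. area_factorial_moment 3 n - (15/128) * sqrt (2 * pi) * real n powr (9/2))"
    unfolding area_factorial_moment_3 by (intro ext) algebra
  finally show ?thesis .
qed

theorem theorem2p9:
  shows "(\<forall>n::nat. n \<ge> 1 \<longrightarrow>
            area_factorial_moment 3 n =
              - (175/192) * real n ^ 4 - (283/192) * real n ^ 3
              + (199/192) * real n ^ 2 + (259/192) * real n
              + ((15/32) * real n ^ 3 + (521/96) * real n ^ 2
                 + (1219/96) * real n + 743/96) * expected_area n)
       \<and> (\<lambda>n::nat. area_factorial_moment 3 n - (15/128) * sqrt (2 * pi) * real n powr (9/2))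
            \<in> O(\<lambda>n. real n ^ 4)"
  using area_factorial_moment_3 area_factorial_moment_3_asymptotics by blast

end
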